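(* There exists a constant $c>0$ such that for every sufficiently large integer $n$ there exists a symmetric complete sum-free subset of $\mathbb{Z}_n$ of size at most $c\cdot\sqrt{n}$.
   Context: $\mathbb{Z}_n$ is the cyclic group of integers modulo $n$. For a subset $S$ of an abelian additive group $G$, $S+S=\{x+y \mid x,y\in S\}$. The set $S$ is symmetric if $x\in S$ implies $-x\in S$, complete if every $z\in G\setminus S$ satisfies $z\in S+S$, and sum-free if $S\cap(S+S)=\emptyset$. *)

theory Defs
  imports Complex_Main "HOL-Algebra.Elementary_Groups"
begin

text \<open>
  The additive abelian group is given as a (multiplicatively written) group record
  \<open>G\<close>, as \<^const>\<open>integer_mod_group\<close> is: there \<open>x \<otimes>\<^bsub>G\<^esub> y\<close> is \<open>(x + y) mod n\<close>,
  so \<open>S <#>\<^bsub>G\<^esub> S\<close> is the sumset \<open>S + S\<close> (equal summands allowed)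
  and \<open>inv\<^bsub>G\<^esub> x\<close> is \<open>- x\<close>. The predicates are meant for \<open>S \<subseteq> carrier G\<close>.
\<close>

definition symmetric_subset :: "('a, 'b) monoid_scheme \<Rightarrow> 'a set \<Rightarrow> bool" where
  "symmetric_subset G S \<longleftrightarrow> (\<forall>x\<in>S. inv\<^bsub>G\<^esub> x \<in> S)"

definition complete_subset :: "('a, 'b) monoid_scheme \<Rightarrow> 'a set \<Rightarrow> bool" where
  "complete_subset G S \<longleftrightarrow> (\<forall>z\<in>carrier G - S. z \<in> S <#>\<^bsub>G\<^esub> S)"

definition sum_free_subset :: "('a, 'b) monoid_scheme \<Rightarrow> 'a set \<Rightarrow> bool" where
  "sum_free_subset G S \<longleftrightarrow> S \<inter> (S <#>\<^bsub>G\<^esub> S) = {}"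

end

theory Submission
  imports Defs
begin

text \<open>
  The set is explicit and has two scales. Take \<open>r\<close> of order \<open>\<surd>n\<close> and consider two kinds of
  integers: a long sparse \<^emph>\<open>comb\<close>, the odd multiples of \<open>r\<close> up to about \<open>n / 3\<close> in absolute
  value with \<open>\<plusminus>r\<close> left out, and a short dense \<^emph>\<open>block\<close> of length less than \<open>3 * r\<close> around a
  multiple \<open>p = 2 * r * m\<close> near \<open>n / 3\<close>, with its centre \<open>p\<close> removed. There are \<open>O(n / r)\<close> teeth
  and \<open>O(r)\<close> elements in the block, so the comb, the block and the negated block
  together have \<open>O(\<surd>n)\<close> elements.

  By symmetry, completeness concerns only the numbers between \<open>0\<close> and \<open>n / 2\<close>. There it comes
  from comb plus block: the teeth are \<open>2 * r\<close> apart and the block contains \<open>p + {1..<2 * r}\<close>, so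
  the sums fill everything except the residue class of \<open>r\<close> modulo \<open>2 * r\<close> and a gap around \<open>p\<close>
  that is due to the missing teeth \<open>\<plusminus>r\<close>. The gap is filled by the block itself, by sums of two
  teeth and by \<open>3 * r\<close> plus the left end of the block. The missing class consists of teeth, of
  \<open>r\<close> (a difference within the block) and of numbers beyond the comb. The last ones are reached
  by going around the cycle: the comb and the negated block hit them because \<open>n\<close> is not a
  multiple of \<open>r\<close>.

  Sum-freeness means that no three elements add up to a multiple of \<open>n\<close>, and each mixture of types
  has its own reason. Three teeth sum to an odd multiple of \<open>r\<close>, which is neither \<open>0\<close> nor \<open>\<plusminus>n\<close>,
  as \<open>r\<close> does not divide \<open>n\<close>, and is too small to be another multiple of \<open>n\<close>. Two teeth and a block
  element never sum to a multiple of \<open>2 * r\<close>, in particular not to \<open>0\<close>, and the comb is too short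
  for the sums \<open>\<plusminus>n\<close>. With at least two elements from the block and its negative, size alone
  decides, where differences within the block are smaller than the smallest positive tooth \<open>3 * r\<close>.

  The size conditions leave an interval of values for \<open>m\<close> and for the number \<open>k\<close> that measures the
  comb, so that every large \<open>n\<close> can be written as \<open>2 * r * (m + 2 * k) + t\<close> with \<open>0 < t < 2 * r\<close>
  and \<open>t \<noteq> r\<close>, as soon as some \<open>r\<close> near \<open>\<surd>n\<close> does not divide \<open>n\<close>; and of two consecutive
  integers above \<open>\<surd>n\<close>, at most one divides \<open>n\<close>.
\<close>

section \<open>Symmetric sets of integers and their residues\<close>

definition residues_mod :: "nat \<Rightarrow> int set \<Rightarrow> int set" where
  "residues_mod n T = (\<lambda>x. x mod int n) ` T"

lemma residues_mod_symmetric: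
  assumes "n > 0" and "\<And>x. x \<in> T \<Longrightarrow> - x \<in> T"
  shows "symmetric_subset (integer_mod_group n) (residues_mod n T)"
  using assms unfolding symmetric_subset_def residues_mod_def
  by (auto simp: carrier_integer_mod_group mod_minus_eq)

text \<open>
  For a symmetric set, a relation \<open>x = y + z\<close> is a zero sum of three elements; in this form the
  roles of the three elements are interchangeable.
\<close>

lemma residues_mod_sum_free:
  assumes "n > 0" and "\<And>x. x \<in> T \<Longrightarrow> - x \<in> T"
    and "\<And>x y z. x \<in> T \<Longrightarrow> y \<in> T \<Longrightarrow> z \<in> T \<Longrightarrow> \<not> int n dvd x + y + z"
  shows "sum_free_subset (integer_mod_group n) (residues_mod n T)"
proof -
  have "x mod int n \<noteq> (y mod int n + z mod int n) mod int n"
    if "x \<in> T" "y \<in> T" "z \<in> T" for x y z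
  proof
    assume "x mod int n = (y mod int n + z mod int n) mod int n"
    then have "(y + z) mod int n = x mod int n"
      by (simp add: mod_add_eq)
    then have "int n dvd y + z - x"
      by (simp add: mod_eq_dvd_iff)
    moreover have "\<not> int n dvd y + z + (- x)"
      using assms(2,3) that by blast
    ultimately show False by simp
  qed
  then show ?thesis
    unfolding sum_free_subset_def residues_mod_def set_mult_def by auto
qed

text \<open>
  Negation preserves both membership and representability, so only the residues in the
  lower half \<open>{0..n div 2}\<close> need to be represented.
\<close>

lemma residues_mod_complete:
  assumes "n > 0" and sym: "\<And>x. x \<in> T \<Longrightarrow> - x \<in> T"
    and half: "\<And>z. 0 \<le> z \<Longrightarrow> 2 * z \<le> int n \<Longrightarrow>
      z \<in> T \<or> (\<exists>x\<in>T. \<exists>y\<in>T. int n dvd z - (x + y))"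
  shows "complete_subset (integer_mod_group n) (residues_mod n T)"
proof -
  have cover: "z \<in> residues_mod n T \<or> (\<exists>x\<in>T. \<exists>y\<in>T. int n dvd z - (x + y))"
    if z: "0 \<le> z" "z < int n" for z
  proof (cases "2 * z \<le> int n")
    case True
    moreover have "z \<in> residues_mod n T" if "z \<in> T"
      unfolding residues_mod_def using that z by (intro image_eqI[of _ _ z]) auto
    ultimately show ?thesis using half[of z] z by blast
  next
    case False
    then consider "int n - z \<in> T"
      | x y where "x \<in> T" "y \<in> T" "int n dvd int n - z - (x + y)"
      using half[of "int n - z"] z by auto
    then show ?thesis
    proof cases
      case 1
      then have "z - int n \<in> T" using sym by fastforce
      moreover have "z = (z - int n) mod int n" using z by simp
      ultimately show ?thesis unfolding residues_mod_def by blast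
    next
      case 2
      have "int n dvd int n - (int n - z - (x + y))"
        by (intro dvd_diff dvd_refl 2(3))
      then have "int n dvd z - (- x + - y)" by (simp add: algebra_simps)
      with 2 sym show ?thesis by blast
    qed
  qed
  have "z \<in> residues_mod n T <#>\<^bsub>integer_mod_group n\<^esub> residues_mod n T"
    if z: "0 \<le> z" "z < int n" and "z \<notin> residues_mod n T" for z
  proof -
    from cover[OF z] that obtain x y
      where xy: "x \<in> T" "y \<in> T" and "int n dvd z - (x + y)" by blast
    then have "z mod int n = (x + y) mod int n"
      by (simp add: mod_eq_dvd_iff)
    then have "z = (x mod int n + y mod int n) mod int n"
      using z by (simp add: mod_add_eq)
    with xy show ?thesis
      unfolding set_mult_def residues_mod_def by auto
  qed
  then show ?thesis
    using assms(1) unfolding complete_subset_def by (auto simp: carrier_integer_mod_group)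
qed

section \<open>The comb and the block\<close>

text \<open>
  The bounds on \<open>k\<close> say that \<open>2 * r * k\<close>, roughly the reach of the comb, lies between the centre
  \<open>2 * r * m\<close> of the block and its double. For \<open>0 < t < 2 * r\<close>, the condition \<open>t \<noteq> r\<close>
  says that \<open>r\<close> does not divide \<open>n\<close>.
\<close>

locale comb_and_block =
  fixes r m k t n :: int
  assumes r_ge: "2 \<le> r"
    and m_ge: "3 \<le> m" and m_less: "m + 2 \<le> k" and k_less: "k \<le> 2 * m - 1"
    and t_pos: "0 < t" and t_less: "t < 2 * r" and t_neq: "t \<noteq> r"
    and n_eq: "n = 2 * r * (m + 2 * k) + t"
begin

text \<open>
  The indices \<open>0\<close> and \<open>-1\<close>, that is the teeth \<open>\<plusminus>r\<close>, are left out because \<open>\<plusminus>r\<close> is a difference of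
  two elements of the block.
\<close>

definition comb :: "int set" where
  "comb = (\<lambda>j. (2 * j + 1) * r) ` ({-k..<k} - {-1, 0})"

text \<open>
  The centre \<open>v = 0\<close> is left out because it is a sum of two teeth. The part \<open>v > 0\<close> represents
  every nonzero residue modulo \<open>2 * r\<close>, which is what covering needs; the part \<open>v < 0\<close> is there to fill the gap that the missing teeth
  leave around the block.
\<close>

definition block :: "int set" where
  "block = (\<lambda>v. 2 * r * m + v) ` ({-r<..<2 * r} - {0})"

definition base :: "int set" where
  "base = comb \<union> block \<union> uminus ` block"

lemma combI: "x = (2 * j + 1) * r \<Longrightarrow> -k \<le> j \<Longrightarrow> j < k \<Longrightarrow> j \<noteq> -1 \<Longrightarrow> j \<noteq> 0 \<Longrightarrow> x \<in> comb"
  unfolding comb_def by auto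

lemma combE:
  assumes "x \<in> comb"
  obtains j where "x = (2 * j + 1) * r" "-k \<le> j" "j < k" "j \<noteq> -1" "j \<noteq> 0"
  using assms unfolding comb_def by (elim imageE DiffE) auto

lemma blockI: "x = 2 * r * m + v \<Longrightarrow> -r < v \<Longrightarrow> v < 2 * r \<Longrightarrow> v \<noteq> 0 \<Longrightarrow> x \<in> block"
  unfolding block_def by auto

lemma blockE:
  assumes "x \<in> block"
  obtains v where "x = 2 * r * m + v" "-r < v" "v < 2 * r" "v \<noteq> 0"
  using assms unfolding block_def by (elim imageE DiffE) auto

lemma comb_uminus: "x \<in> comb \<Longrightarrow> - x \<in> comb"
  by (erule combE, rule_tac j = "- j - 1" in combI) (auto simp: algebra_simps)

lemma base_uminus: "x \<in> base \<Longrightarrow> - x \<in> base"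
  unfolding base_def using comb_uminus by auto

lemma base_cases:
  assumes "x \<in> base"
  obtains "x \<in> comb" | "x \<in> block \<or> - x \<in> block"
  using assms unfolding base_def by auto

lemma comb_bound:
  assumes "x \<in> comb"
  shows "\<bar>x\<bar> \<le> 2 * (r * k) - r" and "3 * r \<le> \<bar>x\<bar>"
proof -
  from assms obtain j where j: "x = (2 * j + 1) * r" "-k \<le> j" "j < k" "j \<noteq> -1" "j \<noteq> 0"
    by (rule combE)
  have abs: "\<bar>x\<bar> = \<bar>2 * j + 1\<bar> * r" using j r_ge by (simp add: abs_mult)
  have "\<bar>2 * j + 1\<bar> * r \<le> (2 * k - 1) * r"
    using j r_ge by (intro mult_right_mono) auto
  then show "\<bar>x\<bar> \<le> 2 * (r * k) - r" using abs by (simp add: algebra_simps)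
  have "3 * r \<le> \<bar>2 * j + 1\<bar> * r"
    using j r_ge by (intro mult_right_mono) auto
  then show "3 * r \<le> \<bar>x\<bar>" using abs by simp
qed

text \<open>
  The parameters enter the size estimates only through the products \<open>r * m\<close> and \<open>r * k\<close>; in terms
  of these the estimates are linear.
\<close>

lemma size_facts:
  shows "n = 2 * (r * m) + 4 * (r * k) + t"
    and "3 * r \<le> r * m" and "r * m + 2 * r \<le> r * k" and "r * k \<le> 2 * (r * m) - r"
proof -
  show "n = 2 * (r * m) + 4 * (r * k) + t" using n_eq by (simp add: algebra_simps)
  show "3 * r \<le> r * m" using mult_left_mono[OF m_ge, of r] r_ge by simp
  show "r * m + 2 * r \<le> r * k" using mult_left_mono[OF m_less, of r] r_ge by (simp add: algebra_simps)
  show "r * k \<le> 2 * (r * m) - r" using mult_left_mono[OF k_less, of r] r_ge by (simp add: algebra_simps)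
qed

lemma not_dvd_n: "\<not> r dvd n"
proof
  assume "r dvd n"
  then have "r dvd t" using n_eq by (simp add: dvd_add_right_iff)
  then obtain q where q: "t = r * q" ..
  have "0 < q" using q t_pos r_ge by (simp add: zero_less_mult_iff)
  moreover have "q < 2" using q t_less r_ge by (simp add: mult.commute)
  ultimately have "q = 1" by simp
  with q t_neq show False by simp
qed

lemma small_multiple:
  assumes "n dvd s" "\<bar>s\<bar> < 2 * n"
  shows "s = 0 \<or> s = n \<or> s = - n"
proof -
  have n_pos: "n > 0" using size_facts r_ge t_pos by linarith
  from assms(1) obtain q where q: "s = n * q" ..
  have "n * \<bar>q\<bar> < n * 2" using assms(2) q n_pos by (simp add: abs_mult)
  then have "\<bar>q\<bar> < 2" using n_pos by (simp add: mult_less_cancel_left)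
  then have "q = 0 \<or> q = 1 \<or> q = -1" by arith
  with q show ?thesis by auto
qed

section \<open>No three elements sum to a multiple of n\<close>

lemma comb_comb_comb:
  assumes "x \<in> comb" "y \<in> comb" "z \<in> comb"
  shows "\<not> n dvd x + y + z"
proof
  assume dvd: "n dvd x + y + z"
  have "\<bar>x + y + z\<bar> < 2 * n"
    using comb_bound(1)[OF assms(1)] comb_bound(1)[OF assms(2)] comb_bound(1)[OF assms(3)]
      size_facts t_pos r_ge by linarith
  with dvd have s: "x + y + z = 0 \<or> x + y + z = n \<or> x + y + z = - n"
    by (rule small_multiple)
  from assms obtain a b c where
    "x = (2 * a + 1) * r" "y = (2 * b + 1) * r" "z = (2 * c + 1) * r"
    by (elim combE) blast
  then have eq: "x + y + z = (2 * (a + b + c + 1) + 1) * r" by (simp add: algebra_simps)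
  then have "r dvd x + y + z" by simp
  moreover have "x + y + z \<noteq> 0" using eq r_ge by (simp del: mult_cancel_right) presburger
  ultimately show False using s not_dvd_n by auto
qed

text \<open>
  Modulo \<open>2 * r\<close> the sum equals the offset \<open>v\<close> inside the block, which excludes the value \<open>0\<close>.
  To reach \<open>n\<close>, the two teeth would have to contribute \<open>4 * r * k + t - v > 4 * r * k - 2 * r\<close>,
  just beyond the largest sum of two teeth.
\<close>

lemma comb_comb_block:
  assumes "x \<in> comb" "y \<in> comb" "q \<in> block"
  shows "\<not> n dvd x + y + q"
proof
  assume dvd: "n dvd x + y + q"
  from assms(3) obtain v where v: "q = 2 * r * m + v" "-r < v" "v < 2 * r" "v \<noteq> 0"
    by (rule blockE)
  from assms obtain a b where ab: "x = (2 * a + 1) * r" "y = (2 * b + 1) * r"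
    by (elim combE) blast
  define e where "e = a + b + 1"
  have xy: "x + y = 2 * r * e" using ab unfolding e_def by (simp add: algebra_simps)
  note bounds = comb_bound(1)[OF assms(1)] comb_bound(1)[OF assms(2)]
  have "\<bar>x + y + q\<bar> < 2 * n"
    using bounds v size_facts t_pos r_ge by linarith
  with dvd have "x + y + q = 0 \<or> x + y + q = n \<or> x + y + q = - n"
    by (rule small_multiple)
  then show False
  proof (elim disjE)
    assume "x + y + q = 0"
    then have "v = 2 * r * (- e - m)" using xy v(1) by (simp add: algebra_simps)
    then obtain w where w: "v = 2 * r * w" by blast
    have "2 * r * w < 2 * r * 1" "2 * r * (-1) < 2 * r * w" using w v r_ge by linarith+
    then have "w < 1" "-1 < w"
      using r_ge mult_less_cancel_left_pos[of "2 * r"] by (meson less_le_trans mult_pos_pos zero_less_numeral)+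
    with w v(4) show False by simp
  next
    assume "x + y + q = n"
    with bounds v size_facts t_pos show False by linarith
  next
    assume "x + y + q = - n"
    with bounds v size_facts t_pos r_ge show False by linarith
  qed
qed

text \<open>
  Only sizes matter. The critical case is \<open>x + p - q = 0\<close>: two elements of the block differ
  by at most \<open>3 * r - 2\<close>, less than the smallest tooth.
\<close>

lemma comb_block_block:
  assumes "x \<in> comb" "p \<in> block" "q \<in> block"
  shows "\<not> n dvd x + p + q" and "\<not> n dvd x + p - q"
proof -
  from assms(2) obtain v where v: "p = 2 * r * m + v" "-r < v" "v < 2 * r" by (rule blockE)
  from assms(3) obtain w where w: "q = 2 * r * m + w" "-r < w" "w < 2 * r" by (rule blockE)
  note bounds = comb_bound[OF assms(1)]
  show "\<not> n dvd x + p + q"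
  proof
    assume "n dvd x + p + q"
    moreover have "\<bar>x + p + q\<bar> < 2 * n"
      using bounds v w size_facts t_pos r_ge by linarith
    ultimately have "x + p + q = 0 \<or> x + p + q = n \<or> x + p + q = - n"
      by (rule small_multiple)
    with bounds v w size_facts t_pos r_ge show False by linarith
  qed
  show "\<not> n dvd x + p - q"
  proof
    assume "n dvd x + p - q"
    moreover have "\<bar>x + p - q\<bar> < 2 * n"
      using bounds v w size_facts t_pos r_ge by linarith
    ultimately have "x + p - q = 0 \<or> x + p - q = n \<or> x + p - q = - n"
      by (rule small_multiple)
    with bounds v w size_facts t_pos r_ge show False by linarith
  qed
qed

lemma block_block_block:
  assumes "p \<in> block" "q \<in> block" "s \<in> block"
  shows "\<not> n dvd p + q + s" and "\<not> n dvd p + q - s"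
proof -
  from assms(1) obtain u where u: "p = 2 * r * m + u" "-r < u" "u < 2 * r" by (rule blockE)
  from assms(2) obtain v where v: "q = 2 * r * m + v" "-r < v" "v < 2 * r" by (rule blockE)
  from assms(3) obtain w where w: "s = 2 * r * m + w" "-r < w" "w < 2 * r" by (rule blockE)
  have "0 < p + q + s" "p + q + s < n" "0 < p + q - s" "p + q - s < n"
    using u v w size_facts t_pos r_ge by linarith+
  then show "\<not> n dvd p + q + s" "\<not> n dvd p + q - s" by (auto dest: zdvd_imp_le)
qed

text \<open>
  Up to a global sign change and a permutation, the choices of signs for the block elements are
  those of the lemmas above; the next three lemmas allow all of them.
\<close>

lemma comb_comb_signed:
  assumes "x \<in> comb" "y \<in> comb" "q \<in> block \<or> - q \<in> block"
  shows "\<not> n dvd x + y + q"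
  using assms(3)
proof
  assume "- q \<in> block"
  with assms comb_uminus have "\<not> n dvd - x + - y + - q" by (intro comb_comb_block)
  moreover have "- x + - y + - q = - (x + y + q)" by simp
  ultimately show ?thesis by (metis dvd_minus_iff)
qed (use assms comb_comb_block in blast)

lemma comb_signed_signed:
  assumes "x \<in> comb" "p \<in> block \<or> - p \<in> block" "q \<in> block \<or> - q \<in> block"
  shows "\<not> n dvd x + p + q"
proof -
  note neg = comb_uminus[OF assms(1)]
  have flip: "n dvd x + p + q \<longleftrightarrow> n dvd - x + - p + - q"
    using dvd_minus_iff[of n "x + p + q"] by (simp add: algebra_simps)
  consider "p \<in> block" "q \<in> block" | "p \<in> block" "- q \<in> block"
    | "- p \<in> block" "q \<in> block" | "- p \<in> block" "- q \<in> block"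
    using assms by blast
  then show ?thesis
  proof cases
    case 1 then show ?thesis using comb_block_block(1) assms(1) by blast
  next
    case 2 then show ?thesis using comb_block_block(2)[of x p "- q"] assms(1) by simp
  next
    case 3 then show ?thesis
      using comb_block_block(2)[of x q "- p"] assms(1) by (simp add: algebra_simps)
  next
    case 4 then show ?thesis using comb_block_block(1)[of "- x" "- p" "- q"] neg flip by simp
  qed
qed

lemma signed_signed_signed:
  assumes "p \<in> block \<or> - p \<in> block" "q \<in> block \<or> - q \<in> block" "s \<in> block \<or> - s \<in> block"
  shows "\<not> n dvd p + q + s"
proof -
  \<comment> \<open>Two of the three elements carry the same sign; after a permutation and a global sign change
    these are \<open>a\<close> and \<open>b\<close>, both in the block.\<close>
  have one_neg: "\<not> n dvd a + b + c"
    if "a \<in> block" "b \<in> block" "c \<in> block \<or> - c \<in> block" for a b c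
    using that block_block_block[of a b c] block_block_block[of a b "- c"] by auto
  have flip: "n dvd p + q + s \<longleftrightarrow> n dvd - p + - q + - s"
    using dvd_minus_iff[of n "p + q + s"] by (simp add: algebra_simps)
  have perm: "p + q + s = p + s + q" "p + q + s = q + s + p"
    "- p + - q + - s = - p + - s + - q" "- p + - q + - s = - q + - s + - p" by simp_all
  consider "p \<in> block" "q \<in> block" | "p \<in> block" "s \<in> block" | "q \<in> block" "s \<in> block"
    | "- p \<in> block" "- q \<in> block" | "- p \<in> block" "- s \<in> block" | "- q \<in> block" "- s \<in> block"
    using assms by blast
  then show ?thesis
  proof cases
    case 1 then show ?thesis using one_neg assms by blast
  next
    case 2 then show ?thesis unfolding perm(1) using one_neg assms by blast
  next
    case 3 then show ?thesis unfolding perm(2) using one_neg assms by blast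
  next
    case 4 then show ?thesis unfolding flip using assms by (intro one_neg) auto
  next
    case 5 then show ?thesis unfolding flip perm(3) using assms by (intro one_neg) auto
  next
    case 6 then show ?thesis unfolding flip perm(4) using assms by (intro one_neg) auto
  qed
qed

lemma base_sum_free:
  assumes "x \<in> base" "y \<in> base" "z \<in> base"
  shows "\<not> n dvd x + y + z"
proof -
  have perm: "x + y + z = x + z + y" "x + y + z = y + z + x" "x + y + z = y + x + z"
    "x + y + z = z + x + y" by simp_all
  show ?thesis
    using assms
    by (elim base_cases)
      (metis perm comb_comb_comb comb_comb_signed comb_signed_signed signed_signed_signed)+
qed

section \<open>Every other residue is a sum of two elements\<close>

lemma base_complete:
  assumes z: "0 \<le> z" "2 * z \<le> n"
  shows "z \<in> base \<or> (\<exists>x\<in>base. \<exists>y\<in>base. n dvd z - (x + y))"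
proof -
  have combB: "x \<in> base" if "x \<in> comb" for x using that unfolding base_def by simp
  have blockB: "x \<in> base" "- x \<in> base" if "x \<in> block" for x
    using that unfolding base_def by auto
  have sumI: ?thesis if "z = x + y" "x \<in> base" "y \<in> base" for x y
    using that by (intro disjI2 bexI[of _ x] bexI[of _ y]) auto
  \<comment> \<open>Locate \<open>z\<close> between consecutive odd multiples of \<open>r\<close>.\<close>
  define h where "h = (z - r) div (2 * r)"
  define v where "v = (z - r) mod (2 * r)"
  have zhv: "z = (2 * h + 1) * r + v"
    using mult_div_mod_eq[of "2 * r" "z - r"] unfolding h_def v_def by (simp add: algebra_simps)
  have v: "0 \<le> v" "v < 2 * r" unfolding v_def using r_ge by auto
  have zlin: "z = 2 * (r * h) + r + v" using zhv by (simp add: algebra_simps)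
  have "r * (-2) < r * h" using z v zlin r_ge by linarith
  then have "-2 < h" using r_ge mult_less_cancel_left_pos[of r "-2" h] by linarith
  then have h_ge: "-1 \<le> h" by simp
  have "r * (2 * h) < r * (m + 2 * k)"
    using zlin v z size_facts(1) t_less by (simp add: algebra_simps)
  then have h_less: "2 * h < m + 2 * k" using r_ge by (simp add: mult_less_cancel_left)
  show ?thesis
  proof (cases "v = 0")
    case True
    \<comment> \<open>\<open>z\<close> is an odd multiple of \<open>r\<close>, the class that comb plus block misses.\<close>
    have "h \<noteq> -1" using zlin True z r_ge by auto
    then consider "h = 0" | "1 \<le> h" "h < k" | "k \<le> h" using h_ge by linarith
    then show ?thesis
    proof cases
      case 1
      have "2 * r * m + (r + 1) \<in> block" "2 * r * m + 1 \<in> block"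
        using r_ge by (auto intro!: blockI)
      then show ?thesis
        using blockB zlin True 1
        by (intro sumI[of "2 * r * m + (r + 1)" "- (2 * r * m + 1)"]) (simp, blast, blast)
    next
      case 2
      then have "z \<in> comb" using zhv True by (intro combI[of _ h]) auto
      then show ?thesis using combB by blast
    next
      case 3
      \<comment> \<open>Beyond the comb: \<open>n\<close> is congruent to \<open>t\<close> modulo \<open>2 * r\<close>, so \<open>z - n\<close> plus the block
        element with offset \<open>t\<close> is an odd multiple of \<open>r\<close>, and short enough to be a tooth.\<close>
      have blk: "- (2 * r * m + t) \<in> base"
        using t_pos t_less r_ge by (intro blockB(2) blockI) auto
      have cmb: "(2 * (h - 2 * k) + 1) * r \<in> base"
        using 3 h_less m_less k_less m_ge by (intro combB combI[OF refl]) auto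
      have "z - (- (2 * r * m + t) + (2 * (h - 2 * k) + 1) * r) = n"
        using zlin True size_facts(1) by (simp add: algebra_simps)
      then have "n dvd z - (- (2 * r * m + t) + (2 * (h - 2 * k) + 1) * r)" by simp
      with blk cmb show ?thesis by blast
    qed
  next
    case False
    \<comment> \<open>The tooth with index \<open>j\<close> and the block element with offset \<open>v\<close> have sum \<open>z\<close>. This fails
      only for the missing teeth, \<open>j = -1\<close> and \<open>j = 0\<close>, where \<open>z\<close> lies strictly between
      \<open>2 * r * m - r\<close> and \<open>2 * r * m + 3 * r\<close>.\<close>
    define j where "j = h - m"
    have zj: "z = (2 * j + 1) * r + (2 * r * m + v)"
      unfolding j_def using zhv by (simp add: algebra_simps)
    have j: "-k \<le> j" "j < k" unfolding j_def using h_ge h_less m_less m_ge by auto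
    consider "j \<noteq> -1" "j \<noteq> 0" | "j = -1" "v \<noteq> r" | "j = -1" "v = r"
      | "j = 0" "v < r" | "j = 0" "v = r" | "j = 0" "r < v" by linarith
    then show ?thesis
    proof cases
      case 1
      have "(2 * j + 1) * r \<in> base" using 1 j by (intro combB combI[OF refl]) auto
      moreover have "2 * r * m + v \<in> base" using False v r_ge by (intro blockB blockI[OF refl]) auto
      ultimately show ?thesis using zj by (intro sumI)
    next
      case 2
      have "z \<in> block" using zj 2 False v r_ge by (intro blockI[of _ "v - r"]) auto
      then show ?thesis using blockB by blast
    next
      case 3
      have "(2 * 1 + 1) * r \<in> base" using m_less m_ge by (intro combB combI[OF refl]) auto
      moreover have "(2 * (m - 2) + 1) * r \<in> base"
        using m_less m_ge by (intro combB combI[OF refl]) auto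
      moreover have "z = (2 * 1 + 1) * r + (2 * (m - 2) + 1) * r"
        using zj 3 by (simp add: algebra_simps)
      ultimately show ?thesis by (intro sumI)
    next
      case 4
      have "z \<in> block" using zj 4 False v r_ge by (intro blockI[of _ "r + v"]) auto
      then show ?thesis using blockB by blast
    next
      case 5
      have "(2 * 1 + 1) * r \<in> base" using m_less m_ge by (intro combB combI[OF refl]) auto
      moreover have "(2 * (m - 1) + 1) * r \<in> base"
        using m_less m_ge by (intro combB combI[OF refl]) auto
      moreover have "z = (2 * 1 + 1) * r + (2 * (m - 1) + 1) * r"
        using zj 5 by (simp add: algebra_simps)
      ultimately show ?thesis by (intro sumI)
    next
      case 6
      \<comment> \<open>Right of the block: add the smallest tooth to the part of the block left of its centre.\<close>
      have "(2 * 1 + 1) * r \<in> base" using m_less m_ge by (intro combB combI[OF refl]) auto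
      moreover have "2 * r * m + (v - 2 * r) \<in> base"
        using 6 v r_ge by (intro blockB blockI[OF refl]) auto
      moreover have "z = (2 * 1 + 1) * r + (2 * r * m + (v - 2 * r))"
        using zj 6 by (simp add: algebra_simps)
      ultimately show ?thesis by (intro sumI)
    qed
  qed
qed

section \<open>Size and choice of parameters\<close>

lemma base_finite: "finite base"
  unfolding base_def comb_def block_def by simp

lemma base_card: "int (card base) \<le> 2 * k + 6 * r"
proof -
  have "card comb \<le> card ({-k..<k} - {-1, 0})"
    unfolding comb_def by (rule card_image_le) simp
  also have "\<dots> \<le> card {-k..<k}" by (rule card_mono) auto
  finally have c: "int (card comb) \<le> 2 * k" using m_less m_ge by simp
  have "card block \<le> card ({-r<..<2 * r} - {0})"
    unfolding block_def by (rule card_image_le) simp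
  also have "\<dots> \<le> card {-r<..<2 * r}" by (rule card_mono) auto
  finally have b: "int (card block) \<le> 3 * r" using r_ge by simp
  have "card (uminus ` block) \<le> card block"
    by (rule card_image_le) (simp add: block_def)
  moreover have "card base \<le> card comb + card block + card (uminus ` block)"
    unfolding base_def by (metis card_Un_le add_le_mono1 order_trans)
  ultimately show ?thesis using b c by linarith
qed

end

text \<open>
  Consecutive integers are coprime, so if both divided \<open>n\<close>, then so would their product, which
  exceeds \<open>n\<close>.
\<close>

lemma nondivisor_near_sqrt:
  fixes n s :: nat
  assumes "n > 0" "n < (s + 1)\<^sup>2"
  obtains r where "r = s + 1 \<or> r = s + 2" "\<not> r dvd n"
proof (cases "s + 1 dvd n \<and> s + 2 dvd n")
  case True
  have "coprime (s + 1) (s + 2)" using coprime_Suc_right_nat[of "s + 1"] by simp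
  with True have "(s + 1) * (s + 2) dvd n" using divides_mult by blast
  then have "(s + 1) * (s + 2) \<le> n" using assms(1) by (rule dvd_imp_le)
  with assms(2) show ?thesis by (simp add: power2_eq_square)
qed (use that in blast)

theorem theorem1p5:
  shows "\<exists>c::real. c > 0 \<and>
    (\<exists>N::nat. \<forall>n\<ge>N. \<exists>S \<subseteq> carrier (integer_mod_group n).
        symmetric_subset (integer_mod_group n) S \<and>
        complete_subset (integer_mod_group n) S \<and>
        sum_free_subset (integer_mod_group n) S \<and>
        finite S \<and> real (card S) \<le> c * sqrt (real n))"
proof (intro exI[of _ "9::real"] conjI exI[of _ "10000::nat"] allI impI)
  fix n :: nat
  assume n: "n \<ge> 10000"
  define s where "s = nat \<lfloor>sqrt (real n)\<rfloor>"
  have s_le: "real s \<le> sqrt (real n)" and s_gt: "sqrt (real n) < real s + 1"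
    unfolding s_def by (simp_all add: floor_correct)
  have "sqrt (real n) < real (s + 1)" using s_gt by simp
  then have "real n < (real (s + 1))\<^sup>2"
    using real_sqrt_less_iff[of "real n" "(real (s + 1))\<^sup>2"] by simp
  then have n_less: "n < (s + 1)\<^sup>2"
    by (metis of_nat_less_iff of_nat_power)
  have "(real s)\<^sup>2 \<le> real n"
    using power_mono[OF s_le, of 2] by simp
  then have s_sq: "s\<^sup>2 \<le> n"
    by (metis of_nat_le_iff of_nat_power)
  have "sqrt 10000 \<le> sqrt (real n)" using n by (intro real_sqrt_le_mono) simp
  moreover have "sqrt 10000 = (100::real)" by (rule real_sqrt_unique) auto
  ultimately have "real s > 99" using s_gt by linarith
  then have s_ge: "100 \<le> s" by simp
  obtain r where r: "r = s + 1 \<or> r = s + 2" "\<not> r dvd n"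
    using nondivisor_near_sqrt[of n s] n n_less by auto
  define l where "l = n div (2 * r)"
  define t where "t = n mod (2 * r)"
  \<comment> \<open>With \<open>m = l - 2 * k\<close>, the conditions \<open>m + 2 \<le> k\<close> and \<open>k \<le> 2 * m - 1\<close> become \<open>l + 2 \<le> 3 * k\<close>
    and \<open>5 * k \<le> 2 * l - 1\<close>; the least \<open>k\<close> with the former satisfies the latter once \<open>l \<ge> 23\<close>.\<close>
  define k where "k = (l + 4) div 3"
  define m where "m = l - 2 * k"
  have nlt: "n = 2 * r * l + t" unfolding l_def t_def by simp
  have r_pos: "r > 0" using r by auto
  have "r dvd n" if "t = 0 \<or> t = r"
    unfolding nlt using that by auto
  then have t: "t < 2 * r" "t \<noteq> 0" "t \<noteq> r"
    using r(2) r_pos unfolding t_def by (simp, metis+)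
  have l_ge: "23 \<le> l"
  proof -
    have "23 * (2 * r) \<le> 46 * (s + 2)" using r by auto
    also have "\<dots> \<le> 100 * s" using s_ge by simp
    also have "\<dots> \<le> s * s" using s_ge by (rule mult_le_mono1)
    finally have "23 * (2 * r) \<le> n" using s_sq by (simp add: power2_eq_square)
    then show ?thesis unfolding l_def using r_pos by (simp add: less_eq_div_iff_mult_less_eq)
  qed
  have "2 * (s + 1) * l \<le> n" using nlt r by (auto simp: algebra_simps)
  then have "(s + 1) * l < (s + 1) * (s + 1)" using n_less by (simp add: power2_eq_square)
  then have "l < s + 1" unfolding mult_less_cancel1 by blast
  then have l_le: "l \<le> s" by simp
  have k: "3 * k \<le> l + 4" "l + 2 \<le> 3 * k" unfolding k_def by linarith+
  interpret comb_and_block "int r" "int m" "int k" "int t" "int n"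
  proof
    show "int n = 2 * int r * (int m + 2 * int k) + int t"
    proof -
      have "l = m + 2 * k" unfolding m_def using k l_ge by linarith
      with nlt have "n = 2 * r * (m + 2 * k) + t" by simp
      then show ?thesis by (metis of_nat_add of_nat_mult of_nat_numeral)
    qed
  qed (use r s_ge t k l_ge in \<open>auto simp: m_def\<close>)
  have n_pos: "n > 0" using n by simp
  let ?S = "residues_mod n base"
  have "card ?S \<le> card base"
    unfolding residues_mod_def by (rule card_image_le[OF base_finite])
  then have "int (card ?S) \<le> 2 * int k + 6 * int r" using base_card by linarith
  also have "\<dots> \<le> 9 * int s" using k l_le r s_ge by auto
  finally have "real (card ?S) \<le> 9 * real s" by linarith
  also have "\<dots> \<le> 9 * sqrt (real n)" using s_le by simp
  finally have card: "real (card ?S) \<le> 9 * sqrt (real n)" .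
  have "?S \<subseteq> carrier (integer_mod_group n)"
    using n_pos unfolding residues_mod_def by (auto simp: carrier_integer_mod_group)
  moreover have "symmetric_subset (integer_mod_group n) ?S"
    using n_pos base_uminus by (rule residues_mod_symmetric)
  moreover have "complete_subset (integer_mod_group n) ?S"
    using n_pos base_uminus base_complete by (rule residues_mod_complete)
  moreover have "sum_free_subset (integer_mod_group n) ?S"
    using n_pos base_uminus base_sum_free by (rule residues_mod_sum_free)
  moreover have "finite ?S" unfolding residues_mod_def using base_finite by simp
  ultimately show "\<exists>S \<subseteq> carrier (integer_mod_group n).
        symmetric_subset (integer_mod_group n) S \<and>
        complete_subset (integer_mod_group n) S \<and>
        sum_free_subset (integer_mod_group n) S \<and>
        finite S \<and> real (card S) \<le> 9 * sqrt (real n)"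
    using card by blast
qed simp

end
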